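(* For all integers $n\ge k\ge 0$, $$\lim_{\lambda\rightarrow 0}H_{\lambda}(n,k)={n \brace k}\quad\text{and}\quad \lim_{\lambda\rightarrow 1}H_{\lambda}(n,k)=L(n,k),$$ where the limits are taken over nonzero real $\lambda$.
   Context: For $\lambda\in\mathbb{R}$, $\lambda\neq 0$: $\langle x\rangle_{0,\lambda}=1$, $\langle x\rangle_{n,\lambda}=x(x+\lambda)\cdots(x+(n-1)\lambda)$ for $n\ge 1$. The falling factorial is $(x)_0=1$, $(x)_n=x(x-1)\cdots(x-n+1)$ for $n\ge 1$. The heterogeneous Stirling numbers of the second kind $H_\lambda(n,k)$ are defined by the polynomial identity $\langle x\rangle_{n,\lambda}=\sum_{k=0}^{n}H_{\lambda}(n,k)(x)_{k}$ for $n\ge 0$. Here ${n\brace k}$ are the classical Stirling numbers of the second kind, $x^{n}=\sum_{k=0}^{n}{n \brace k}(x)_{k}$, and the Lah numbers $L(n,k)$ are defined by $\frac{1}{k!}\left(\frac{t}{1-t}\right)^{k}=\sum_{n=k}^{\infty}L(n,k)\frac{t^{n}}{n!}$ for $k\ge 0$. *)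

theory Defs
  imports
    Complex_Main
    "HOL-Combinatorics.Stirling"
    "HOL-Computational_Algebra.Formal_Power_Series"
begin

definition deg_rising :: "real \<Rightarrow> real \<Rightarrow> nat \<Rightarrow> real"
  where "deg_rising lam x n = (\<Prod>i<n. x + real i * lam)"

definition falling :: "real \<Rightarrow> nat \<Rightarrow> real"
  where "falling x n = (\<Prod>i<n. x - real i)"

lemma falling_of_nat_eq_0: "m < k \<Longrightarrow> falling (real m) k = 0"
  by (auto simp: falling_def)

lemma falling_of_nat_self_neq_0: "falling (real k) k \<noteq> 0"
  by (auto simp: falling_def)

lemma mult_falling: "x * falling x k = falling x (Suc k) + real k * falling x k"
  by (simp add: falling_def algebra_simps)

lemma falling_coeffs_unique:
  assumes "\<And>x. (\<Sum>k\<le>n. c k * falling x k) = (\<Sum>k\<le>n. d k * falling x k)"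
    and "k \<le> n"
  shows "c k = d k"
  using assms(2)
proof (induction k rule: less_induct)
  case (less k)
  let ?s = "\<lambda>c. (\<Sum>j\<le>n. c j * falling (real k) j)"
  have *: "?s b = (\<Sum>j<k. b j * falling (real k) j) + b k * falling (real k) k" for b :: "nat \<Rightarrow> real"
  proof -
    have "?s b = (\<Sum>j\<le>k. b j * falling (real k) j)"
      using less.prems by (intro sum.mono_neutral_right) (auto simp: falling_of_nat_eq_0)
    then show ?thesis
      by (simp add: lessThan_Suc_atMost [symmetric])
  qed
  have "(\<Sum>j<k. c j * falling (real k) j) = (\<Sum>j<k. d j * falling (real k) j)"
    using less by (intro sum.cong) auto
  then show ?case
    using assms(1) [of "real k"] * [of c] * [of d] falling_of_nat_self_neq_0 [of k] by simp
qed

lemma falling_coeffs_exist: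
  "\<exists>c. (\<forall>k>n. c k = 0) \<and> (\<forall>x. deg_rising lam x n = (\<Sum>k\<le>n. c k * falling x k))"
proof (induction n)
  case 0
  show ?case
    by (rule exI [of _ "\<lambda>k. if k = 0 then 1 else 0"]) (simp add: deg_rising_def falling_def)
next
  case (Suc n)
  then obtain c where c0: "\<And>k. k > n \<Longrightarrow> c k = 0"
    and c: "\<And>x. deg_rising lam x n = (\<Sum>k\<le>n. c k * falling x k)"
    by blast
  define d where "d k = (case k of 0 \<Rightarrow> 0 | Suc j \<Rightarrow> c j) + (real k + real n * lam) * c k" for k
  have "deg_rising lam x (Suc n) = (\<Sum>k\<le>Suc n. d k * falling x k)" for x
  proof -
    have "deg_rising lam x (Suc n) = (\<Sum>k\<le>n. c k * falling x k) * (x + real n * lam)"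
      by (simp add: c [symmetric]) (simp add: deg_rising_def)
    also have "\<dots> = (\<Sum>k\<le>n. c k * (x * falling x k) + real n * lam * c k * falling x k)"
      unfolding sum_distrib_right by (intro sum.cong) (auto simp: algebra_simps)
    also have "\<dots> = (\<Sum>k\<le>n. c k * falling x (Suc k)) + (\<Sum>k\<le>n. (real k + real n * lam) * c k * falling x k)"
      by (simp add: mult_falling sum.distrib [symmetric] algebra_simps)
    also have "(\<Sum>k\<le>n. c k * falling x (Suc k)) =
        (\<Sum>k\<le>Suc n. (case k of 0 \<Rightarrow> 0 | Suc j \<Rightarrow> c j) * falling x k)"
      by (subst sum.atMost_Suc_shift) simp
    also have "(\<Sum>k\<le>n. (real k + real n * lam) * c k * falling x k) =
        (\<Sum>k\<le>Suc n. (real k + real n * lam) * c k * falling x k)"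
      by (simp add: c0)
    finally show ?thesis
      by (simp add: d_def sum.distrib [symmetric] distrib_right)
  qed
  moreover have "\<forall>k>Suc n. d k = 0"
    by (auto simp: d_def c0 split: nat.split)
  ultimately show ?case
    by blast
qed

text \<open>The polynomial identity only involves the coefficients with \<open>k \<le> n\<close>; the others are set to 0.\<close>

definition het_Stirling :: "real \<Rightarrow> nat \<Rightarrow> nat \<Rightarrow> real"
  where "het_Stirling lam n =
    (THE c. (\<forall>k>n. c k = 0) \<and> (\<forall>x. deg_rising lam x n = (\<Sum>k\<le>n. c k * falling x k)))"

lemma het_Stirling_spec:
  "(\<forall>k>n. het_Stirling lam n k = 0) \<and>
   (\<forall>x. deg_rising lam x n = (\<Sum>k\<le>n. het_Stirling lam n k * falling x k))"
proof -
  have "\<exists>!c. (\<forall>k>n. c k = 0) \<and> (\<forall>x. deg_rising lam x n = (\<Sum>k\<le>n. c k * falling x k))"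
  proof (rule ex_ex1I [OF falling_coeffs_exist])
    fix c d
    assume "(\<forall>k>n. c k = 0) \<and> (\<forall>x. deg_rising lam x n = (\<Sum>k\<le>n. c k * falling x k))"
      and "(\<forall>k>n. d k = 0) \<and> (\<forall>x. deg_rising lam x n = (\<Sum>k\<le>n. d k * falling x k))"
    then show "c = d"
      by (metis (no_types, lifting) ext falling_coeffs_unique not_le)
  qed
  from theI' [OF this] show ?thesis
    unfolding het_Stirling_def .
qed

text \<open>The library defines \<^const>\<open>Stirling\<close> by its recurrence; it has the defining property
  \<open>x\<^sup>n = (\<Sum>k\<le>n. Stirling n k * (x)\<^sub>k)\<close>.\<close>

lemma power_eq_sum_Stirling: "x ^ n = (\<Sum>k\<le>n. real (Stirling n k) * falling x k)"
proof (induction n)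
  case 0
  show ?case
    by (simp add: falling_def)
next
  case (Suc n)
  have "x ^ Suc n = (\<Sum>k\<le>n. real (Stirling n k) * (x * falling x k))"
    by (simp add: Suc sum_distrib_left algebra_simps)
  also have "\<dots> = (\<Sum>k\<le>n. real (Stirling n k) * falling x (Suc k)) +
      (\<Sum>k\<le>Suc n. real k * real (Stirling n k) * falling x k)"
    by (simp add: mult_falling sum.distrib [symmetric] algebra_simps)
  also have "(\<Sum>k\<le>Suc n. real k * real (Stirling n k) * falling x k) =
      (\<Sum>k\<le>n. real (Suc k) * real (Stirling n (Suc k)) * falling x (Suc k))"
    by (subst sum.atMost_Suc_shift) simp
  also have "(\<Sum>k\<le>n. real (Stirling n k) * falling x (Suc k)) + \<dots> =
      (\<Sum>k\<le>Suc n. real (Stirling (Suc n) k) * falling x k)"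
    by (subst sum.atMost_Suc_shift) (simp add: sum.distrib [symmetric] algebra_simps)
  finally show ?case .
qed

definition Lah :: "nat \<Rightarrow> nat \<Rightarrow> real"
  where "Lah n k = fact n * fps_nth (fps_const (1 / fact k) * (fps_X / (1 - fps_X)) ^ k) n"

text \<open>The generating function of the Lah numbers starts at \<open>n = k\<close>.\<close>

lemma Lah_eq_0: "n < k \<Longrightarrow> Lah n k = 0"
proof -
  assume "n < k"
  have "(fps_X / (1 - fps_X) :: real fps) = fps_X * inverse (1 - fps_X)"
    by (simp add: fps_divide_unit)
  then show ?thesis
    using \<open>n < k\<close> by (simp add: Lah_def power_mult_distrib fps_X_power_mult_nth)
qed

lemma Lah_egf:
  "fps_const (1 / fact k) * (fps_X / (1 - fps_X)) ^ k = Abs_fps (\<lambda>n. Lah n k / fact n)"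
  by (rule fps_ext) (simp add: Lah_def)

end

(* The numbers H_lam(n,k) satisfy H_lam(n+1,k) = H_lam(n,k-1) + (k + n lam) H_lam(n,k), so they
   are polynomials in lam and the limits are the values at lam = 0 and lam = 1. At lam = 0 the
   defining identity is that of the Stirling numbers. At lam = 1 the recurrence is that of the
   Lah numbers, which comes from the equation (1 - t) u' = 1 + u for u = t / (1 - t). *)

theory Submission
  imports Defs
begin

lemma het_Stirling_eq_0: "n < k \<Longrightarrow> het_Stirling lam n k = 0"
  using het_Stirling_spec by blast

lemma deg_rising_eq_sum_het_Stirling:
  "deg_rising lam x n = (\<Sum>k\<le>n. het_Stirling lam n k * falling x k)"
  using het_Stirling_spec by blast

text \<open>Falling factorials are linearly independent, so any expansion of
  \<open>deg_rising lam x n\<close> in them must have the numbers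
  \<open>het_Stirling lam n k\<close> as coefficients. Values and recurrence are then found by
  exhibiting an expansion.\<close>

lemma het_Stirling_unique:
  assumes "\<And>x. deg_rising lam x n = (\<Sum>k\<le>n. c k * falling x k)" and "k \<le> n"
  shows "het_Stirling lam n k = c k"
  by (rule falling_coeffs_unique [OF _ assms(2)])
    (simp add: assms(1) flip: deg_rising_eq_sum_het_Stirling)

lemma het_Stirling_0: "het_Stirling lam 0 k = (if k = 0 then 1 else 0)"
  using het_Stirling_unique [of lam 0 "\<lambda>_. 1" 0]
  by (auto simp: het_Stirling_eq_0 deg_rising_def falling_def)

text \<open>Multiply the expansion for n by the new factor x + n lam and use x (x)_k = (x)_{k+1} + k
  (x)_k. The \<open>case\<close> supplies 0 for the missing index k - 1 at k = 0.\<close>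

lemma het_Stirling_Suc:
  "het_Stirling lam (Suc n) k =
    (case k of 0 \<Rightarrow> 0 | Suc j \<Rightarrow> het_Stirling lam n j) + (real k + real n * lam) * het_Stirling lam n k"
proof (cases "k \<le> Suc n")
  case True
  let ?c = "het_Stirling lam n"
  let ?s = "\<lambda>k. case k of 0 \<Rightarrow> 0 | Suc j \<Rightarrow> ?c j"
  have "deg_rising lam x (Suc n) = (\<Sum>k\<le>Suc n. (?s k + (real k + real n * lam) * ?c k) * falling x k)" for x
  proof -
    have "deg_rising lam x (Suc n) = (\<Sum>k\<le>n. ?c k * falling x k) * (x + real n * lam)"
      by (simp flip: deg_rising_eq_sum_het_Stirling) (simp add: deg_rising_def)
    also have "\<dots> = (\<Sum>k\<le>n. ?c k * (x * falling x k) + real n * lam * ?c k * falling x k)"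
      unfolding sum_distrib_right by (intro sum.cong) (auto simp: algebra_simps)
    also have "\<dots> = (\<Sum>k\<le>n. ?c k * falling x (Suc k)) + (\<Sum>k\<le>n. (real k + real n * lam) * ?c k * falling x k)"
      by (simp add: mult_falling sum.distrib [symmetric] algebra_simps)
    also have "(\<Sum>k\<le>n. ?c k * falling x (Suc k)) = (\<Sum>k\<le>Suc n. ?s k * falling x k)"
      by (subst sum.atMost_Suc_shift) simp
    \<comment> \<open>The added term vanishes since H(n, n+1) = 0; both sums now run to n +
      1.\<close>
    also have "(\<Sum>k\<le>n. (real k + real n * lam) * ?c k * falling x k) =
        (\<Sum>k\<le>Suc n. (real k + real n * lam) * ?c k * falling x k)"
      by (simp add: het_Stirling_eq_0)
    finally show ?thesis
      by (simp only: sum.distrib [symmetric] distrib_right)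
  qed
  then show ?thesis
    using True by (rule het_Stirling_unique)
next
  case False
  then show ?thesis
    by (auto simp: het_Stirling_eq_0 split: nat.split)
qed

text \<open>Each step of the recurrence only adds and multiplies continuous functions of lam; k is
  arbitrary because the step also refers to k - 1.\<close>

lemma isCont_het_Stirling: "isCont (\<lambda>lam. het_Stirling lam n k) a"
proof (induction n arbitrary: k)
  case 0
  show ?case
    by (simp add: het_Stirling_0)
next
  case (Suc n)
  show ?case
    unfolding het_Stirling_Suc by (cases k) (auto intro!: continuous_intros Suc)
qed

text \<open>At lam = 0 every factor x + i lam is x, so the rising product is x^n.\<close>

lemma het_Stirling_at_0:
  assumes "k \<le> n"
  shows "het_Stirling 0 n k = real (Stirling n k)"
  using _ assms by (rule het_Stirling_unique) (simp add: deg_rising_def flip: power_eq_sum_Stirling)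

lemma Lah_0_left: "Lah 0 k = (if k = 0 then 1 else 0)"
  by (auto simp: Lah_eq_0) (simp add: Lah_def)

lemma Lah_0_right: "Lah n 0 = (if n = 0 then 1 else 0)"
  by (simp add: Lah_def)

text \<open>With F_k = u^k / k!, the chain rule gives F_{k+1}' = F_k u'. Multiplying by 1 - t and
  using F_k u = (k+1) F_{k+1} yields (1 - t) F_{k+1}' = F_k + (k+1) F_{k+1}; now compare
  coefficients of t^n.\<close>

lemma Lah_Suc_Suc: "Lah (Suc n) (Suc k) = Lah n k + (real n + real (Suc k)) * Lah n (Suc k)"
proof -
  define u :: "real fps" where "u = fps_X / (1 - fps_X)"
  define F where "F k = fps_const (1 / fact k) * u ^ k" for k
  have F_nth: "fps_nth (F k) n = Lah n k / fact n" for n k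
    by (simp add: F_def u_def Lah_def)
  have u: "(1 - fps_X) * u = fps_X"
    unfolding u_def by (simp add: fps_divide_unit mult.left_commute inverse_mult_eq_1')
  then have "fps_deriv ((1 - fps_X) * u) = 1"
    by simp
  then have u': "(1 - fps_X) * fps_deriv u = 1 + u"
    by (simp add: algebra_simps)
  \<comment> \<open>Read from right to left, this splits 1/k! so that the identities for F_{k+1}
    below hold by reordering factors.\<close>
  have fact_cancel: "fps_const (1 / fact (Suc k)) * fps_const (real (Suc k)) = fps_const (1 / fact k)"
    by simp
  have "fps_deriv (F (Suc k)) =
      fps_const (1 / fact (Suc k)) * (fps_const (real (Suc k)) * fps_deriv u * u ^ k)"
    by (simp only: F_def fps_deriv_mult_const_left fps_deriv_power diff_Suc_1)
  then have "fps_deriv (F (Suc k)) = F k * fps_deriv u"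
    unfolding F_def [of k] fact_cancel [symmetric] by (simp only: mult_ac)
  then have "(1 - fps_X) * fps_deriv (F (Suc k)) = F k * (1 + u)"
    by (simp add: mult.left_commute u')
  also have "F k * u = fps_const (real (Suc k)) * F (Suc k)"
    unfolding F_def fact_cancel [symmetric] by (simp only: power_Suc mult_ac)
  then have "F k * (1 + u) = F k + fps_const (real (Suc k)) * F (Suc k)"
    by (simp add: distrib_left)
  finally have eq: "(1 - fps_X) * fps_deriv (F (Suc k)) = F k + fps_const (real (Suc k)) * F (Suc k)" .
  have nth: "fps_nth ((1 - fps_X) * fps_deriv f) n = real (Suc n) * fps_nth f (Suc n) - real n * fps_nth f n"
    for f :: "real fps"
    \<comment> \<open>At n = 0 the product with \<open>fps_X\<close> contributes nothing, in
      agreement with the factor n.\<close>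
    by (cases n) (simp_all add: left_diff_distrib)
  have cancel: "real (Suc n) * (x / fact (Suc n)) = x / fact n" for x
    by simp
  have "fps_nth ((1 - fps_X) * fps_deriv (F (Suc k))) n =
      (Lah (Suc n) (Suc k) - real n * Lah n (Suc k)) / fact n"
    unfolding nth F_nth cancel by (simp add: diff_divide_distrib)
  moreover have "fps_nth (F k + fps_const (real (Suc k)) * F (Suc k)) n =
      (Lah n k + real (Suc k) * Lah n (Suc k)) / fact n"
    by (simp only: fps_add_nth fps_mult_left_const_nth F_nth add_divide_distrib times_divide_eq_right)
  ultimately have "Lah (Suc n) (Suc k) - real n * Lah n (Suc k) = Lah n k + real (Suc k) * Lah n (Suc k)"
    using eq by (simp del: of_nat_Suc)
  then show ?thesis
    by (simp add: algebra_simps)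
qed

text \<open>At lam = 1 the factor k + n lam becomes n + k, so both arrays have the same recurrence
  and initial row.\<close>

lemma het_Stirling_at_1: "het_Stirling 1 n k = Lah n k"
proof (induction n arbitrary: k)
  case 0
  show ?case
    by (simp add: het_Stirling_0 Lah_0_left)
next
  case (Suc n)
  show ?case
  proof (cases k)
    case 0
    then show ?thesis
      by (simp add: het_Stirling_Suc Suc Lah_0_right)
  next
    case (Suc j)
    then show ?thesis
      by (simp add: het_Stirling_Suc Suc.IH Lah_Suc_Suc algebra_simps)
  qed
qed

theorem mainTheorem10:
  fixes n k :: nat
  assumes "k \<le> n"
  shows "((\<lambda>lam. het_Stirling lam n k) \<longlongrightarrow> real (Stirling n k)) (at 0) \<and>
         ((\<lambda>lam. het_Stirling lam n k) \<longlongrightarrow> Lah n k) (at 1)"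
  \<comment> \<open>Continuity identifies each limit with the value at the point. The filter
    \<open>at 0\<close> leaves out lam = 0, and lam near 1 is nonzero, so both are limits over
    nonzero lam.\<close>
  using isCont_het_Stirling [where n = n and k = k and a = 0]
    isCont_het_Stirling [where n = n and k = k and a = 1]
  unfolding isCont_def het_Stirling_at_0 [OF assms] het_Stirling_at_1 by blast

end
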